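(* Let $C=\{(p_1,q_1),\ldots,(p_n,q_n)\}$ be a menu such that every pair in it has positive demand, labeled so that $p_i<p_j$ whenever $i<j$. Let $C'=\{(p_{\mu(1)},q_{\mu(1)}),\ldots,(p_{\mu(k)},q_{\mu(k)})\}\subseteq C$, where $\mu(i)\in\{1,\ldots,n\}$ and $\mu(i)<\mu(j)$ whenever $i<j$, and define $\mu(0)=0$. Assume that $\mu(k)=n$. Then: (1) $\pi(C)\le\pi(C')$ if $F(m)m$ is convex on $[m_{\mu(j-1)+1}(C),\,m_{\mu(j)}(C)]$ for all $j\in\{1,\ldots,k\}$ such that $\mu(j)-\mu(j-1)>1$. (2) $\pi(C)\ge\pi(C')$ if $F(m)m$ is concave on $[m_{\mu(j-1)+1}(C),\,m_{\mu(j)}(C)]$ for all $j\in\{1,\ldots,k\}$ such that $\mu(j)-\mu(j-1)>1$.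
   Context: Buyers' types $m$ are distributed according to a continuous cumulative distribution function $F$ (on $\mathbb{R}$) with a density $f$, supported on an interval $[a,b]\subseteq[0,\infty)$, $a<b$ (so $F$ is strictly increasing on $[a,b]$, $F(a)=0$, $F(b)=1$). A menu is a finite nonempty set $C=\{(p_1,q_1),\ldots,(p_n,q_n)\}$ of distinct price-quality pairs with $p_i\ge 0$, $q_i>0$. A type $m$ buyer gets utility $mq-p$ from the pair $(p,q)$ and $0$ from not buying. The demand for $(p_i,q_i)$ is $$D_i(C)=\int_a^b 1\{mq_i-p_i\ge 0\}\,1\{mq_i-p_i=\max_{(p_j,q_j)\in C}(mq_j-p_j)\}\,F(dm)$$ (ties have mass zero), and the total transaction value (revenue) is $\pi(C)=\sum_{(p_i,q_i)\in C}p_iD_i(C)$. For a menu $C=\{(p_1,q_1),\ldots,(p_n,q_n)\}$ all of whose pairs have positive demand, labeled with increasing prices (then qualities are increasing as well), define $m_i(C)=(p_i-p_{i-1})/(q_i-q_{i-1})$ for $i=1,\ldots,n$, where $p_0=q_0=0$. *)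

theory Defs
  imports "HOL-Probability.Probability"
begin

text \<open>
  The law of the buyers' types is the measure \<open>M\<close>, with cumulative distribution function
  \<open>cdf M\<close> and density \<open>f\<close>. That the support is the whole of \<open>[a, b]\<close> is expressed by
  \<open>F(a) = 0\<close>, \<open>F(b) = 1\<close> and strict monotonicity of \<open>F\<close> on \<open>[a, b]\<close>.
\<close>

locale type_distribution = real_distribution M
  for M :: "real measure" +
  fixes f :: "real \<Rightarrow> real" and a b :: real
  assumes f_measurable: "f \<in> borel_measurable borel"
    and f_nonneg: "\<And>m. 0 \<le> f m"
    and M_density: "M = density lborel (\<lambda>m. ennreal (f m))"
    and a_nonneg: "0 \<le> a"
    and a_less_b: "a < b"
    and cdf_a: "cdf M a = 0"
    and cdf_b: "cdf M b = 1"
    and cdf_strict_mono: "strict_mono_on {a..b} (cdf M)"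
begin

lemma continuous_cdf: "continuous_on UNIV (cdf M)"
proof -
  have "emeasure M {x} = 0" for x
    unfolding M_density using f_measurable
    by (subst emeasure_density) (auto simp: nn_integral_0_iff_AE intro: AE_I[of _ _ "{x}"])
  then have "isCont (cdf M) x" for x
    by (simp add: isCont_cdf measure_def)
  then show ?thesis
    by (simp add: continuous_at_imp_continuous_on)
qed

end

text \<open>A price-quality pair is \<open>(p, q)\<close>, with the price as its first component.\<close>

definition is_menu :: "(real \<times> real) set \<Rightarrow> bool" where
  "is_menu C \<longleftrightarrow> finite C \<and> C \<noteq> {} \<and> (\<forall>(p, q)\<in>C. 0 \<le> p \<and> 0 < q)"

definition utility :: "real \<Rightarrow> real \<times> real \<Rightarrow> real" where
  "utility m x = m * snd x - fst x"

definition demand ::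
    "real measure \<Rightarrow> real \<Rightarrow> real \<Rightarrow> (real \<times> real) set \<Rightarrow> real \<times> real \<Rightarrow> real" where
  "demand M a b C x =
     (LINT m:{a..b}|M. of_bool (utility m x \<ge> 0) * of_bool (utility m x = Max (utility m ` C)))"

definition revenue :: "real measure \<Rightarrow> real \<Rightarrow> real \<Rightarrow> (real \<times> real) set \<Rightarrow> real" where
  "revenue M a b C = (\<Sum>x\<in>C. fst x * demand M a b C x)"

text \<open>
  The cutoff \<open>m\<^sub>i(C)\<close> of a menu whose pairs are labeled \<open>(p 1, q 1), \<dots>, (p n, q n)\<close>;
  the labeling is meant to be extended by \<open>p 0 = q 0 = 0\<close>.
\<close>

definition cutoff :: "(nat \<Rightarrow> real) \<Rightarrow> (nat \<Rightarrow> real) \<Rightarrow> nat \<Rightarrow> real" where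
  "cutoff p q i = (p i - p (i - 1)) / (q i - q (i - 1))"

end

theory Submission
  imports Defs
begin

text \<open>
  For an increasing labeling with increasing cutoffs \<open>m\<^sub>i\<close>, the pair \<open>i\<close> is bought exactly by the
  types in \<open>[m\<^sub>i, m\<^sub>i\<^sub>+\<^sub>1]\<close>, and summation by parts turns the revenue into
  \<open>p\<^sub>n - (\<Sum>i. (q\<^sub>i - q\<^sub>i\<^sub>-\<^sub>1) G(m\<^sub>i))\<close> with \<open>G(m) = F(m) m\<close>. Deleting pairs while keeping the last one
  replaces the cutoffs of each block \<open>\<mu>(j-1) < i \<le> \<mu>(j)\<close> by their average with weights
  \<open>q\<^sub>i - q\<^sub>i\<^sub>-\<^sub>1\<close>, so the comparison is Jensen's inequality for \<open>G\<close> on each block.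
\<close>

section \<open>Probabilities of intervals and demand as a probability\<close>

context type_distribution
begin

lemma prob_singleton: "prob {x} = 0"
proof -
  have "isCont (cdf M) x"
    using continuous_cdf by (simp add: continuous_on_eq_continuous_at)
  then show ?thesis
    by (simp add: isCont_cdf)
qed

lemma prob_atLeastAtMost:
  assumes "x \<le> y"
  shows "prob {x..y} = cdf M y - cdf M x"
proof (cases "x = y")
  case True
  then show ?thesis
    by (simp add: prob_singleton)
next
  case False
  then have "x < y"
    using assms by simp
  have "{x..y} = {x<..y} \<union> {x}"
    using \<open>x < y\<close> by auto
  then have "prob {x..y} = prob {x<..y} + prob {x}"
    using finite_measure_Union[of "{x<..y}" "{x}"] by simp
  then show ?thesis
    using cdf_diff_eq[OF \<open>x < y\<close>] by (simp add: prob_singleton)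
qed

lemma prob_atLeast: "prob {x..} = 1 - cdf M x"
proof -
  have "prob (space M - {..x}) = 1 - cdf M x"
    by (subst prob_compl) (simp_all add: cdf_def)
  moreover have "space M - {..x} = {x<..}"
    by auto
  ultimately have "prob {x<..} = 1 - cdf M x"
    by simp
  moreover have "{x..} = {x<..} \<union> {x}"
    by auto
  then have "prob {x..} = prob {x<..} + prob {x}"
    using finite_measure_Union[of "{x<..}" "{x}"] by simp
  ultimately show ?thesis
    by (simp add: prob_singleton)
qed

text \<open>The values of \<open>cdf M\<close> at \<open>a\<close> and \<open>b\<close> put all mass
  on \<open>{a..b}\<close>. Demand, defined by an integral over \<open>{a..b}\<close>, can thus be
  computed on the whole line, wherever the cutoffs lie.\<close>

lemma prob_Int_support:
  assumes "A \<in> sets borel"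
  shows "prob ({a..b} \<inter> A) = prob A"
proof -
  have "prob {a..b} = 1"
    using prob_atLeastAtMost[of a b] a_less_b cdf_a cdf_b by simp
  then have "AE m in M. m \<in> {a..b}"
    by (simp add: prob_eq_1)
  then show ?thesis
    using assms by (intro finite_measure_eq_AE) auto
qed

lemma demand_eq_prob:
  assumes "finite C" "x \<in> C"
  shows "demand M a b C x =
    prob {m \<in> {a..b}. 0 \<le> utility m x \<and> (\<forall>y\<in>C. utility m y \<le> utility m x)}"
    (is "_ = prob ?A")
proof -
  have "utility m x = Max (utility m ` C) \<longleftrightarrow> (\<forall>y\<in>C. utility m y \<le> utility m x)" for m
    using assms by (auto intro: Max_eqI[symmetric])
  then have "demand M a b C x = integral\<^sup>L M (indicator ?A)"
    unfolding demand_def set_lebesgue_integral_def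
    by (intro Bochner_Integration.integral_cong) (auto simp: indicator_def)
  then show ?thesis
    by simp
qed

text \<open>Points have mass zero, so a set of types of positive mass is not contained in any
  singleton.\<close>

lemma demand_pos_obtains:
  assumes "finite C" "x \<in> C" "demand M a b C x > 0"
  obtains m m' where "m < m'" "m \<in> {a..b}" "m' \<in> {a..b}"
    "\<And>t. t \<in> {m, m'} \<Longrightarrow> 0 \<le> utility t x \<and> (\<forall>y\<in>C. utility t y \<le> utility t x)"
proof -
  let ?A = "{m \<in> {a..b}. 0 \<le> utility m x \<and> (\<forall>y\<in>C. utility m y \<le> utility m x)}"
  have pos: "prob ?A > 0"
    using assms demand_eq_prob by simp
  have not_sub: "\<not> ?A \<subseteq> {c}" for c
  proof
    assume "?A \<subseteq> {c}"
    then have "prob ?A \<le> prob {c}"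
      by (intro finite_measure_mono) auto
    then show False
      using pos by (simp add: prob_singleton)
  qed
  obtain s where s: "s \<in> ?A"
    using not_sub[of 0] by blast
  obtain t where t: "t \<in> ?A" "t \<noteq> s"
    using not_sub[of s] by blast
  show thesis
    using that[of "min s t" "max s t"] s t
    by (cases "s < t") (auto simp: min_def max_def)
qed

end

section \<open>Cutoffs and optimal choice\<close>

text \<open>The cutoff is the type indifferent between the pairs \<open>i - 1\<close> and
  \<open>i\<close>. As the quality increment is positive, comparing neighbours amounts to the sign
  of \<open>m - cutoff p q i\<close>.\<close>

lemma utility_step:
  assumes "q (i - 1) < q i"
  shows "utility m (p i, q i) - utility m (p (i - 1), q (i - 1)) =
    (q i - q (i - 1)) * (m - cutoff p q i)"
  using assms unfolding utility_def cutoff_def by (simp add: field_simps)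

text \<open>With increasing cutoffs, the utility of a fixed type first rises and then falls in the
  index, so beating the two neighbours means beating everything. Index \<open>0\<close> will stand
  for not buying; pair \<open>n\<close> has no right neighbour, hence the guard
  \<open>i < n\<close>.\<close>

lemma optimal_iff_cutoffs:
  fixes p q :: "nat \<Rightarrow> real"
  assumes q: "\<And>l. l \<in> {1..n} \<Longrightarrow> q (l - 1) < q l"
    and cut: "mono_on {1..n} (cutoff p q)"
    and i: "i \<in> {1..n}"
  shows "(\<forall>j\<in>{0..n}. utility m (p j, q j) \<le> utility m (p i, q i)) \<longleftrightarrow>
    cutoff p q i \<le> m \<and> (i < n \<longrightarrow> m \<le> cutoff p q (Suc i))"
    (is "?L \<longleftrightarrow> ?R")
proof -
  let ?g = "\<lambda>l. utility m (p l, q l)"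
  have step: "?g l - ?g (l - 1) = (q l - q (l - 1)) * (m - cutoff p q l)" if "l \<in> {1..n}" for l
    using utility_step q that by blast
  show ?thesis
  proof
    assume L: ?L
    have "0 \<le> (q i - q (i - 1)) * (m - cutoff p q i)"
      using L i step[OF i] by (metis atLeastAtMost_iff diff_ge_0_iff_ge diff_le_self le0 le_trans)
    then have "cutoff p q i \<le> m"
      using q[OF i] by (simp add: zero_le_mult_iff)
    moreover have "m \<le> cutoff p q (Suc i)" if "i < n"
    proof -
      have "(q (Suc i) - q i) * (m - cutoff p q (Suc i)) \<le> 0"
        using L step[of "Suc i"] that by (metis Suc_leI atLeastAtMost_iff diff_Suc_1
            diff_le_0_iff_le le0 le_numeral_extra(4) not_less_eq_eq One_nat_def)
      then show ?thesis
        using q[of "Suc i"] that by (simp add: mult_le_0_iff)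
    qed
    ultimately show ?R by simp
  next
    assume R: ?R
    \<comment> \<open>A type at or above cutoff \<open>i\<close> is above all earlier cutoffs, so
      utility does not fall on the way up to \<open>i\<close>; \<open>down\<close> is the mirror
      image beyond \<open>i\<close>.\<close>
    have up: "?g (l - 1) \<le> ?g l" if "l \<in> {1..i}" for l
    proof -
      have "cutoff p q l \<le> cutoff p q i"
        using cut that i by (auto intro: mono_onD)
      then have "0 \<le> (q l - q (l - 1)) * (m - cutoff p q l)"
        using R q[of l] that i by simp
      then show ?thesis
        using step[of l] that i by simp
    qed
    have down: "?g (Suc l) \<le> ?g l" if "i \<le> l" "l < n" for l
    proof -
      have "cutoff p q (Suc i) \<le> cutoff p q (Suc l)"
        using cut that i by (auto intro: mono_onD)
      then have "(q (Suc l) - q l) * (m - cutoff p q (Suc l)) \<le> 0"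
        using R q[of "Suc l"] that i by (simp add: mult_nonneg_nonpos)
      then show ?thesis
        using step[of "Suc l"] that i by simp
    qed
    have "?g j \<le> ?g i" if "j \<le> i" for j
      using that
    proof (induction rule: inc_induct)
      case (step l)
      then show ?case
        using up[of "Suc l"] by simp
    qed simp
    moreover have "?g j \<le> ?g i" if "i \<le> j" "j \<le> n" for j
      using that
    proof (induction rule: dec_induct)
      case (step l)
      then show ?case
        using down[of l] by simp
    qed simp
    ultimately show ?L
      by (metis atLeastAtMost_iff nle_le)
  qed
qed

section \<open>The revenue formula\<close>

text \<open>Abel summation: \<open>p 0 = 0\<close> removes the lower boundary term, and the upper
  one becomes \<open>p n\<close> once \<open>h (Suc n) = 1\<close>.\<close>

lemma sum_by_parts:
  fixes p h :: "nat \<Rightarrow> real"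
  assumes "p 0 = 0"
  shows "(\<Sum>i=1..n. p i * (h (Suc i) - h i)) =
    p n * h (Suc n) - (\<Sum>i=1..n. (p i - p (i - 1)) * h i)"
  using assms by (induction n) (auto simp: algebra_simps)

context type_distribution
begin

text \<open>The hypotheses ask for monotone qualities and cutoffs, so that the formula serves both
  the full menu and the submenu.\<close>

lemma revenue_eq:
  fixes p q :: "nat \<Rightarrow> real"
  assumes C: "C = (\<lambda>i. (p i, q i)) ` {1..n}"
    and p0: "p 0 = 0" and q0: "q 0 = 0"
    and q: "strict_mono_on {0..n} q"
    and cut: "mono_on {1..n} (cutoff p q)"
  shows "revenue M a b C =
    p n - (\<Sum>i=1..n. (q i - q (i - 1)) * (cdf M (cutoff p q i) * cutoff p q i))"
proof -
  let ?c = "cutoff p q"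
  \<comment> \<open>The default \<open>1\<close> encodes that the buyers of pair \<open>n\<close>
    have no upper cutoff; every demand is then a difference of consecutive values of
    \<open>h\<close>.\<close>
  define h where "h i = (if i \<le> n then cdf M (?c i) else 1)" for i
  have qi: "q (l - 1) < q l" if "l \<in> {1..n}" for l
    using q that by (auto intro: strict_mono_onD)
  have inj: "inj_on (\<lambda>i. (p i, q i)) {1..n}"
  proof (rule inj_onI)
    fix i j assume "i \<in> {1..n}" "j \<in> {1..n}" "(p i, q i) = (p j, q j)"
    then show "i = j"
      using q by (auto dest!: strict_mono_on_imp_inj_on intro: inj_onD)
  qed
  have dem: "demand M a b C (p i, q i) = h (Suc i) - h i" if i: "i \<in> {1..n}" for i
  proof -
    \<comment> \<open>Since \<open>p 0 = q 0 = 0\<close>, the participation constraint is the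
      comparison with index \<open>0\<close>.\<close>
    have "0 \<le> utility m (p i, q i) \<and> (\<forall>y\<in>C. utility m y \<le> utility m (p i, q i)) \<longleftrightarrow>
        (\<forall>j\<in>{0..n}. utility m (p j, q j) \<le> utility m (p i, q i))" for m
    proof -
      have "{0..n} = insert 0 {1..n}"
        by auto
      then show ?thesis
        unfolding C by (simp add: utility_def p0 q0)
    qed
    then have "demand M a b C (p i, q i) =
        prob ({a..b} \<inter> {m. ?c i \<le> m \<and> (i < n \<longrightarrow> m \<le> ?c (Suc i))})"
      using i optimal_iff_cutoffs[OF qi cut i]
      by (subst demand_eq_prob) (auto simp: C Int_def conj_assoc)
    also have "\<dots> = prob {m. ?c i \<le> m \<and> (i < n \<longrightarrow> m \<le> ?c (Suc i))}"
      by (rule prob_Int_support) measurable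
    also have "\<dots> = h (Suc i) - h i"
    proof (cases "i < n")
      case True
      have "{m. ?c i \<le> m \<and> (i < n \<longrightarrow> m \<le> ?c (Suc i))} = {?c i..?c (Suc i)}"
        using True by auto
      moreover have "?c i \<le> ?c (Suc i)"
        using cut True i by (auto intro: mono_onD)
      ultimately show ?thesis
        using True by (simp add: prob_atLeastAtMost h_def)
    next
      case False
      have "{m. ?c i \<le> m \<and> (i < n \<longrightarrow> m \<le> ?c (Suc i))} = {?c i..}"
        using False by auto
      then show ?thesis
        using False i by (simp add: prob_atLeast h_def)
    qed
    finally show ?thesis .
  qed
  have "revenue M a b C = (\<Sum>i=1..n. p i * demand M a b C (p i, q i))"
    unfolding revenue_def C by (subst sum.reindex[OF inj]) simp
  also have "\<dots> = (\<Sum>i=1..n. p i * (h (Suc i) - h i))"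
    using dem by simp
  also have "\<dots> = p n - (\<Sum>i=1..n. (p i - p (i - 1)) * h i)"
    using sum_by_parts[where p = p and h = h and n = n] p0 by (simp add: h_def)
  \<comment> \<open>Each price increment is the quality increment times the cutoff, which makes
    \<open>F(m) m\<close> appear.\<close>
  also have "(\<Sum>i=1..n. (p i - p (i - 1)) * h i) =
      (\<Sum>i=1..n. (q i - q (i - 1)) * (cdf M (?c i) * ?c i))"
  proof (rule sum.cong)
    fix i assume "i \<in> {1..n}"
    then show "(p i - p (i - 1)) * h i = (q i - q (i - 1)) * (cdf M (?c i) * ?c i)"
      using qi[of i] by (simp add: h_def cutoff_def)
  qed simp
  finally show ?thesis .
qed

section \<open>Monotone qualities and cutoffs from positive demand\<close>

text \<open>Positive demand gives each pair a type \<open>m \<ge> 0\<close> for which it is optimal.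
  Such a type accepts a higher price only for a higher quality, and it lies between the cutoffs of
  its pair and of the next one, which orders these cutoffs.\<close>

lemma labeling_mono:
  fixes p q :: "nat \<Rightarrow> real"
  assumes menu: "is_menu C" and C: "C = (\<lambda>i. (p i, q i)) ` {1..n}"
    and p: "strict_mono_on {1..n} p"
    and p0: "p 0 = 0" and q0: "q 0 = 0"
    and dem: "\<forall>x\<in>C. demand M a b C x > 0"
  shows "strict_mono_on {0..n} q" and "mono_on {1..n} (cutoff p q)"
proof -
  have opt: "\<exists>m m'. m < m' \<and> 0 \<le> m \<and> (\<forall>t\<in>{m, m'}. \<forall>j\<in>{0..n}.
      utility t (p j, q j) \<le> utility t (p i, q i))" if i: "i \<in> {1..n}" for i
  proof -
    have x: "(p i, q i) \<in> C"
      using i C by blast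
    have "finite C"
      using C by simp
    then obtain m m' where m: "m < m'" "m \<in> {a..b}" "m' \<in> {a..b}"
      "\<And>t. t \<in> {m, m'} \<Longrightarrow>
        0 \<le> utility t (p i, q i) \<and> (\<forall>y\<in>C. utility t y \<le> utility t (p i, q i))"
      using demand_pos_obtains x dem by metis
    have "utility t (p j, q j) \<le> utility t (p i, q i)" if "t \<in> {m, m'}" "j \<in> {0..n}" for t j
    proof (cases "j = 0")
      case True
      then show ?thesis
        using m(4)[OF that(1)] p0 q0 by (simp add: utility_def)
    next
      case False
      then have "(p j, q j) \<in> C"
        using that C by auto
      then show ?thesis
        using m(4)[OF that(1)] by blast
    qed
    then show ?thesis
      using m a_nonneg by (intro exI[of _ m] exI[of _ m']) auto
  qed
  have q_pos: "q i > 0" if "i \<in> {1..n}" for i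
    using menu C that unfolding is_menu_def by auto
  show q: "strict_mono_on {0..n} q"
  proof (rule strict_mono_onI)
    fix i j assume ij: "i \<in> {0..n}" "j \<in> {0..n}" "i < j"
    show "q i < q j"
    \<comment> \<open>Prices are strictly increasing only from index \<open>1\<close> on
      (\<open>p 1\<close> may be \<open>0\<close>), so index \<open>0\<close> is settled by
      positivity of the qualities.\<close>
    proof (cases "i = 0")
      case True
      then show ?thesis
        using q_pos[of j] ij q0 by simp
    next
      case False
      then have "p i < p j"
        using p ij by (auto intro: strict_mono_onD)
      obtain m where m: "0 \<le> m" "utility m (p i, q i) \<le> utility m (p j, q j)"
        using opt[of j] ij by fastforce
      then have "m * (q j - q i) > 0"
        using \<open>p i < p j\<close> by (simp add: utility_def algebra_simps)
      then show ?thesis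
        using m(1) by (simp add: zero_less_mult_iff)
    qed
  qed
  have qi: "q (l - 1) < q l" if "l \<in> {1..n}" for l
    using q that by (auto intro: strict_mono_onD)
  have cut_step: "cutoff p q i \<le> cutoff p q (Suc i)" if i: "i \<in> {1..n}" "i < n" for i
  proof -
    obtain m where m: "\<forall>j\<in>{0..n}. utility m (p j, q j) \<le> utility m (p i, q i)"
      using opt[OF i(1)] by blast
    have "i - 1 \<in> {0..n}" "Suc i \<in> {0..n}" "Suc i \<in> {1..n}"
      using i by auto
    then have "utility m (p (i - 1), q (i - 1)) \<le> utility m (p i, q i)"
        "utility m (p (Suc i), q (Suc i)) \<le> utility m (p i, q i)"
      using m by blast+
    then have "0 \<le> (q i - q (i - 1)) * (m - cutoff p q i)"
        "(q (Suc i) - q i) * (m - cutoff p q (Suc i)) \<le> 0"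
      using utility_step[OF qi[OF i(1)], of m p]
        utility_step[OF qi[OF \<open>Suc i \<in> {1..n}\<close>], of m p] by simp_all
    then have "cutoff p q i \<le> m" "m \<le> cutoff p q (Suc i)"
      using qi[OF i(1)] qi[of "Suc i"] i by (auto simp: zero_le_mult_iff mult_le_0_iff)
    then show ?thesis by simp
  qed
  show "mono_on {1..n} (cutoff p q)"
  proof (rule mono_onI)
    fix i j assume ij: "i \<in> {1..n}" "j \<in> {1..n}" "i \<le> j"
    from \<open>i \<le> j\<close> have "j \<le> n \<longrightarrow> cutoff p q i \<le> cutoff p q j"
    proof (induction rule: dec_induct)
      case (step l)
      then show ?case
        using cut_step[of l] ij by auto
    qed simp
    then show "cutoff p q i \<le> cutoff p q j"
      using ij by simp
  qed
qed

end

section \<open>Block sums, averaged cutoffs and Jensen's inequality\<close>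

lemma sum_telescope_block:
  fixes g :: "nat \<Rightarrow> real"
  assumes "u \<le> v"
  shows "(\<Sum>i=Suc u..v. g i - g (i - 1)) = g v - g u"
  using assms by (induction rule: dec_induct) auto

lemma sum_blocks:
  fixes g :: "nat \<Rightarrow> real" and \<mu> :: "nat \<Rightarrow> nat"
  assumes "mono_on {0..k} \<mu>" "\<mu> 0 = 0"
  shows "(\<Sum>i=1..\<mu> k. g i) = (\<Sum>j=1..k. \<Sum>i=Suc (\<mu> (j - 1))..\<mu> j. g i)"
  using assms(1)
proof (induction k)
  case 0
  then show ?case
    using assms(2) by simp
next
  case (Suc k)
  have "\<mu> k \<le> \<mu> (Suc k)"
    using Suc.prems by (auto intro: mono_onD)
  then have "(\<Sum>i=1..\<mu> (Suc k). g i) = (\<Sum>i=1..\<mu> k. g i) + (\<Sum>i=Suc (\<mu> k)..\<mu> (Suc k). g i)"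
    using sum.ub_add_nat[of 1 "\<mu> k" g "\<mu> (Suc k) - \<mu> k"] by simp
  moreover have "mono_on {0..k} \<mu>"
    using Suc.prems by (rule mono_on_subset) auto
  ultimately show ?case
    using Suc.IH by simp
qed

text \<open>For consecutive kept indices \<open>u\<close> and \<open>v\<close>, the quotient
  \<open>(p v - p u) / (q v - q u)\<close> is the cutoff of \<open>v\<close> in the submenu.
  Telescoping the price increments exhibits it as a weighted mean of the old cutoffs in the
  block.\<close>

lemma cutoff_block_average:
  fixes p q :: "nat \<Rightarrow> real"
  assumes "u < v" and q: "strict_mono_on {u..v} q"
  shows "(\<Sum>i=Suc u..v. (q i - q (i - 1)) / (q v - q u)) = 1"
    and "(p v - p u) / (q v - q u) =
      (\<Sum>i=Suc u..v. ((q i - q (i - 1)) / (q v - q u)) * cutoff p q i)"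
proof -
  have "q u < q v"
    using assms by (auto intro: strict_mono_onD)
  then show "(\<Sum>i=Suc u..v. (q i - q (i - 1)) / (q v - q u)) = 1"
    using sum_telescope_block[of u v q] \<open>u < v\<close> by (simp flip: sum_divide_distrib)
  have "(q i - q (i - 1)) / (q v - q u) * cutoff p q i = (p i - p (i - 1)) / (q v - q u)"
    if "i \<in> {Suc u..v}" for i
  proof -
    have "q (i - 1) < q i"
      using that by (intro strict_mono_onD[OF q]) auto
    then show ?thesis
      by (simp add: cutoff_def)
  qed
  then have "(\<Sum>i=Suc u..v. ((q i - q (i - 1)) / (q v - q u)) * cutoff p q i) =
      (\<Sum>i=Suc u..v. (p i - p (i - 1)) / (q v - q u))"
    by (intro sum.cong) auto
  also have "\<dots> = (p v - p u) / (q v - q u)"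
    using sum_telescope_block[of u v p] \<open>u < v\<close> by (simp flip: sum_divide_distrib)
  finally show "(p v - p u) / (q v - q u) =
      (\<Sum>i=Suc u..v. ((q i - q (i - 1)) / (q v - q u)) * cutoff p q i)"
    by (rule sym)
qed

text \<open>A weighted mean stays in the interval containing the averaged values, here bounded by
  the first and last cutoffs of the block.\<close>

lemma cutoff_block_between:
  fixes p q :: "nat \<Rightarrow> real"
  assumes "u < v" and q: "strict_mono_on {u..v} q"
    and cut: "mono_on {Suc u..v} (cutoff p q)"
  shows "(p v - p u) / (q v - q u) \<in> {cutoff p q (Suc u)..cutoff p q v}"
proof -
  have w: "0 \<le> (q i - q (i - 1)) / (q v - q u)" if "i \<in> {Suc u..v}" for i
  proof -
    have "q (i - 1) < q i" "q u < q v"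
      using that by (auto intro!: strict_mono_onD[OF q])
    then show ?thesis by simp
  qed
  have "cutoff p q i \<in> {cutoff p q (Suc u)..cutoff p q v}" if "i \<in> {Suc u..v}" for i
    using cut that by (auto intro: mono_onD)
  then have "(\<Sum>i=Suc u..v. ((q i - q (i - 1)) / (q v - q u)) *\<^sub>R cutoff p q i)
      \<in> {cutoff p q (Suc u)..cutoff p q v}"
    using w cutoff_block_average(1)[OF assms(1,2)] by (intro convex_sum) auto
  then show ?thesis
    using cutoff_block_average(2)[OF assms(1,2), of p] by simp
qed

text \<open>Jensen's inequality for the weights above, multiplied by \<open>q v - q u\<close>.
  \<open>G\<close> is arbitrary so that the concave case can use the negated function.\<close>

lemma cutoff_block_Jensen:
  fixes p q :: "nat \<Rightarrow> real"
  assumes "u < v" and q: "strict_mono_on {u..v} q"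
    and cut: "mono_on {Suc u..v} (cutoff p q)"
    and G: "v - u > 1 \<Longrightarrow> convex_on {cutoff p q (Suc u)..cutoff p q v} G"
  shows "(q v - q u) * G ((p v - p u) / (q v - q u)) \<le>
    (\<Sum>i=Suc u..v. (q i - q (i - 1)) * G (cutoff p q i))"
proof (cases "v - u > 1")
  case False
  \<comment> \<open>A block of one pair loses nothing: the mean is its only cutoff and equality
    holds without convexity.\<close>
  then have "v = Suc u"
    using \<open>u < v\<close> by simp
  then show ?thesis
    by (simp add: cutoff_def)
next
  case True
  have "q u < q v"
    using assms by (auto intro: strict_mono_onD)
  have w: "0 \<le> (q i - q (i - 1)) / (q v - q u)" if "i \<in> {Suc u..v}" for i
  proof -
    have "q (i - 1) < q i"
      using that by (intro strict_mono_onD[OF q]) auto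
    then show ?thesis
      using \<open>q u < q v\<close> by simp
  qed
  have "cutoff p q i \<in> {cutoff p q (Suc u)..cutoff p q v}" if "i \<in> {Suc u..v}" for i
    using cut that by (auto intro: mono_onD)
  then have "G (\<Sum>i=Suc u..v. ((q i - q (i - 1)) / (q v - q u)) *\<^sub>R cutoff p q i) \<le>
      (\<Sum>i=Suc u..v. ((q i - q (i - 1)) / (q v - q u)) * G (cutoff p q i))"
    using w cutoff_block_average(1)[OF assms(1,2)] G[OF True] \<open>u < v\<close>
    by (intro convex_on_sum) auto
  also have "\<dots> = (\<Sum>i=Suc u..v. (q i - q (i - 1)) * G (cutoff p q i)) / (q v - q u)"
    by (simp add: sum_divide_distrib)
  finally have "G ((p v - p u) / (q v - q u)) \<le>
      (\<Sum>i=Suc u..v. (q i - q (i - 1)) * G (cutoff p q i)) / (q v - q u)"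
    using cutoff_block_average(2)[OF assms(1,2), of p] by simp
  then show ?thesis
    using \<open>q u < q v\<close> by (simp add: pos_le_divide_eq mult.commute)
qed

lemma sum_Jensen_blocks:
  fixes p q :: "nat \<Rightarrow> real"
  assumes \<mu>: "strict_mono_on {0..k} \<mu>" "\<mu> 0 = 0"
    and q: "strict_mono_on {0..\<mu> k} q"
    and cut: "mono_on {1..\<mu> k} (cutoff p q)"
    and G: "\<And>j. j \<in> {1..k} \<Longrightarrow> \<mu> j - \<mu> (j - 1) > 1 \<Longrightarrow>
      convex_on {cutoff p q (\<mu> (j - 1) + 1)..cutoff p q (\<mu> j)} G"
  shows "(\<Sum>j=1..k. (q (\<mu> j) - q (\<mu> (j - 1))) * G (cutoff (p \<circ> \<mu>) (q \<circ> \<mu>) j)) \<le>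
    (\<Sum>i=1..\<mu> k. (q i - q (i - 1)) * G (cutoff p q i))"
proof -
  have "(q (\<mu> j) - q (\<mu> (j - 1))) * G (cutoff (p \<circ> \<mu>) (q \<circ> \<mu>) j) \<le>
      (\<Sum>i=Suc (\<mu> (j - 1))..\<mu> j. (q i - q (i - 1)) * G (cutoff p q i))"
    if j: "j \<in> {1..k}" for j
  proof -
    have "\<mu> (j - 1) < \<mu> j"
      using \<mu>(1) j by (auto intro: strict_mono_onD)
    moreover have "\<mu> j \<le> \<mu> k"
      using \<mu>(1) j by (auto intro: strict_mono_on_leD)
    then have "strict_mono_on {\<mu> (j - 1)..\<mu> j} q" "mono_on {Suc (\<mu> (j - 1))..\<mu> j} (cutoff p q)"
      using q cut by (auto intro: monotone_on_subset)
    ultimately show ?thesis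
      using cutoff_block_Jensen[of "\<mu> (j - 1)" "\<mu> j" q p G] G[OF j] by (simp add: cutoff_def)
  qed
  then have "(\<Sum>j=1..k. (q (\<mu> j) - q (\<mu> (j - 1))) * G (cutoff (p \<circ> \<mu>) (q \<circ> \<mu>) j)) \<le>
      (\<Sum>j=1..k. \<Sum>i=Suc (\<mu> (j - 1))..\<mu> j. (q i - q (i - 1)) * G (cutoff p q i))"
    by (rule sum_mono)
  also have "\<dots> = (\<Sum>i=1..\<mu> k. (q i - q (i - 1)) * G (cutoff p q i))"
    using sum_blocks[of k \<mu>] \<mu> by (simp add: strict_mono_on_imp_mono_on)
  finally show ?thesis .
qed

text \<open>Each new cutoff lies in the range of the old cutoffs of its block, and the blocks follow
  one another in order. This makes the revenue formula available for the submenu.\<close>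

lemma mono_on_cutoff_submenu:
  fixes p q :: "nat \<Rightarrow> real"
  assumes \<mu>: "strict_mono_on {0..k} \<mu>"
    and q: "strict_mono_on {0..\<mu> k} q"
    and cut: "mono_on {1..\<mu> k} (cutoff p q)"
  shows "mono_on {1..k} (cutoff (p \<circ> \<mu>) (q \<circ> \<mu>))"
proof (rule mono_onI)
  fix i j assume ij: "i \<in> {1..k}" "j \<in> {1..k}" "i \<le> j"
  have between: "\<mu> (l - 1) < \<mu> l \<and> \<mu> l \<le> \<mu> k \<and> cutoff (p \<circ> \<mu>) (q \<circ> \<mu>) l \<in>
      {cutoff p q (Suc (\<mu> (l - 1)))..cutoff p q (\<mu> l)}" if l: "l \<in> {1..k}" for l
  proof -
    have "\<mu> (l - 1) < \<mu> l"
      using \<mu> l by (auto intro: strict_mono_onD)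
    moreover have "\<mu> l \<le> \<mu> k"
      using \<mu> l by (auto intro: strict_mono_on_leD)
    moreover from this have "strict_mono_on {\<mu> (l - 1)..\<mu> l} q"
        "mono_on {Suc (\<mu> (l - 1))..\<mu> l} (cutoff p q)"
      using q cut by (auto intro: monotone_on_subset)
    ultimately show ?thesis
      using cutoff_block_between[of "\<mu> (l - 1)" "\<mu> l" q p] by (simp add: cutoff_def)
  qed
  show "cutoff (p \<circ> \<mu>) (q \<circ> \<mu>) i \<le> cutoff (p \<circ> \<mu>) (q \<circ> \<mu>) j"
  proof (cases "i = j")
    case False
    \<comment> \<open>From \<open>i \<le> j - 1\<close>, block \<open>i\<close> ends before block
      \<open>j\<close> starts at \<open>Suc (\<mu> (j - 1))\<close>.\<close>
    then have "\<mu> i \<le> \<mu> (j - 1)"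
      using \<mu> ij by (auto intro: strict_mono_on_leD)
    then have "cutoff p q (\<mu> i) \<le> cutoff p q (Suc (\<mu> (j - 1)))"
      using between[OF ij(1)] between[OF ij(2)] by (intro mono_onD[OF cut]) auto
    then show ?thesis
      using between[OF ij(1)] between[OF ij(2)] by auto
  qed simp
qed

section \<open>Comparison of the two revenues\<close>

theorem proposition1:
  fixes M :: "real measure" and f :: "real \<Rightarrow> real" and a b :: real
    and C C' :: "(real \<times> real) set"
    and p q :: "nat \<Rightarrow> real" and n k :: nat and \<mu> :: "nat \<Rightarrow> nat"
  assumes "type_distribution M f a b"
    and "is_menu C"
    and "C = (\<lambda>i. (p i, q i)) ` {1..n}"
    and "strict_mono_on {1..n} p"
    and "p 0 = 0" and "q 0 = 0"
    and "\<forall>x\<in>C. demand M a b C x > 0"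
    and "C' = (\<lambda>i. (p (\<mu> i), q (\<mu> i))) ` {1..k}"
    and "\<forall>i\<in>{1..k}. \<mu> i \<in> {1..n}"
    and "strict_mono_on {1..k} \<mu>"
    and "\<mu> 0 = 0"
    and "\<mu> k = n"
  shows
    "((\<forall>j\<in>{1..k}. \<mu> j - \<mu> (j - 1) > 1 \<longrightarrow>
         convex_on {cutoff p q (\<mu> (j - 1) + 1)..cutoff p q (\<mu> j)} (\<lambda>m. cdf M m * m))
       \<longrightarrow> revenue M a b C \<le> revenue M a b C') \<and>
     ((\<forall>j\<in>{1..k}. \<mu> j - \<mu> (j - 1) > 1 \<longrightarrow>
         concave_on {cutoff p q (\<mu> (j - 1) + 1)..cutoff p q (\<mu> j)} (\<lambda>m. cdf M m * m))
       \<longrightarrow> revenue M a b C \<ge> revenue M a b C')"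
proof -
  interpret type_distribution M f a b
    by (rule assms(1))
  let ?G = "\<lambda>m. cdf M m * m"
  let ?block = "\<lambda>j. {cutoff p q (\<mu> (j - 1) + 1)..cutoff p q (\<mu> j)}"
  let ?S = "\<lambda>G. \<Sum>i=1..\<mu> k. (q i - q (i - 1)) * G (cutoff p q i)"
  let ?S' = "\<lambda>G. \<Sum>j=1..k. (q (\<mu> j) - q (\<mu> (j - 1))) * G (cutoff (p \<circ> \<mu>) (q \<circ> \<mu>) j)"
  \<comment> \<open>Monotonicity extends to index \<open>0\<close> because
    \<open>\<mu> 0 = 0\<close> while all other values are at least \<open>1\<close>.\<close>
  have \<mu>: "strict_mono_on {0..k} \<mu>"
  proof (rule strict_mono_onI)
    fix i j assume ij: "i \<in> {0..k}" "j \<in> {0..k}" "i < j"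
    show "\<mu> i < \<mu> j"
    proof (cases "i = 0")
      case True
      have "\<mu> j \<in> {1..n}"
        using assms(9) ij by simp
      then show ?thesis
        using True assms(11) by simp
    next
      case False
      then show ?thesis
        using assms(10) ij by (auto intro: strict_mono_onD)
    qed
  qed
  have q: "strict_mono_on {0..\<mu> k} q" and cut: "mono_on {1..\<mu> k} (cutoff p q)"
    using labeling_mono[OF assms(2-7)] assms(12) by simp_all
  have q': "strict_mono_on {0..k} (q \<circ> \<mu>)"
  proof (rule strict_mono_onI)
    fix i j assume ij: "i \<in> {0..k}" "j \<in> {0..k}" "i < j"
    then have "\<mu> i < \<mu> j" "\<mu> j \<le> \<mu> k"
      using \<mu> by (auto intro: strict_mono_onD strict_mono_on_leD)
    then show "(q \<circ> \<mu>) i < (q \<circ> \<mu>) j"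
      using q by (auto intro: strict_mono_onD)
  qed
  have C: "C = (\<lambda>i. (p i, q i)) ` {1..\<mu> k}"
    using assms(3,12) by simp
  have rev: "revenue M a b C = p n - ?S ?G"
    using revenue_eq[OF C assms(5,6) q cut] assms(12) by simp
  have "C' = (\<lambda>i. ((p \<circ> \<mu>) i, (q \<circ> \<mu>) i)) ` {1..k}"
    using assms(8) by simp
  \<comment> \<open>As the last pair is kept (\<open>\<mu> k = n\<close>), both revenues have the
    leading term \<open>p n\<close>, and only the sums \<open>?S\<close> and \<open>?S'\<close>
    remain to be compared.\<close>
  then have rev': "revenue M a b C' = p n - ?S' ?G"
    using revenue_eq[of C' "p \<circ> \<mu>" "q \<circ> \<mu>" k] assms(5,6,11,12) q'
      mono_on_cutoff_submenu[OF \<mu> q cut] by simp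
  have Jensen: "?S' G \<le> ?S G"
    if "\<And>j. j \<in> {1..k} \<Longrightarrow> \<mu> j - \<mu> (j - 1) > 1 \<Longrightarrow> convex_on (?block j) G" for G
    using sum_Jensen_blocks[OF \<mu> assms(11) q cut] that by blast
  show ?thesis
  proof (intro conjI impI)
    assume "\<forall>j\<in>{1..k}. \<mu> j - \<mu> (j - 1) > 1 \<longrightarrow> convex_on (?block j) ?G"
    then have "?S' ?G \<le> ?S ?G"
      by (intro Jensen) blast
    then show "revenue M a b C \<le> revenue M a b C'"
      using rev rev' by simp
  next
    assume "\<forall>j\<in>{1..k}. \<mu> j - \<mu> (j - 1) > 1 \<longrightarrow> concave_on (?block j) ?G"
    \<comment> \<open>Concavity of \<open>?G\<close> is convexity of its negative; both sums are
      linear in the function, so the inequality reverses.\<close>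
    then have "?S' (\<lambda>m. - ?G m) \<le> ?S (\<lambda>m. - ?G m)"
      by (intro Jensen) (simp add: concave_on_def)
    then show "revenue M a b C \<ge> revenue M a b C'"
      using rev rev' by (simp add: sum_negf)
  qed
qed

end
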